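(* Let $n\ge1$, $r>0$, $a_i,b_i\in C(\mathbb{R},\mathbb{R})$ for $i=1,\dots,n$, $\mathbf{A}(t)=\mathrm{diag}[a_1(t),\dots,a_n(t)]$, $\mathbf{B}(t)=\mathrm{diag}[b_1(t),\dots,b_n(t)]$, and let $\mathbf{F}:\mathscr{C}\to\mathbb{R}^n$ be continuous with $\mathbf{F}(\hat 0)=0$. Assume: (i) $L>0$ and $K_L>0$ are constants such that $|\mathbf{F}(\varphi)-\mathbf{F}(\psi)|\le K_L\|\varphi-\psi\|$ for all $\varphi,\psi\in\mathscr{C}_L:=\{\mathbf{x}\in\mathscr{C}:\|\mathbf{x}\|\le L\}$; (ii) there exists $\alpha\in(0,1)$ such that $$K_L\int_0^t\exp\Big\{-\int_s^t a_i(u)\,du\Big\}|b_i(s)|\,ds\le\alpha\qquad\text{for all } t\ge0,\ i=1,\dots,n;$$ (iii) $\liminf_{t\to+\infty}\int_0^t a_i(s)\,ds>-\infty$ for each $i=1,\dots,n$. If the zero solution of $$\mathbf{x}'(t)=-\mathbf{A}(t)\mathbf{x}(t)+\mathbf{B}(t)\mathbf{F}(\mathbf{x}_t)$$ is asymptotically stable, then $$\int_0^t a_i(s)\,ds\to+\infty\quad\text{as } t\to+\infty,\qquad i=1,\dots,n.$$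
   Context: $\mathbb{R}^n$ carries the max norm $|\cdot|$. $\mathscr{C}=C([-r,0],\mathbb{R}^n)$ is the Banach space of continuous functions with norm $\|\phi\|=\sup_{-r\le\theta\le0}|\phi(\theta)|$, and $\hat0$ is its zero element. For a function $\mathbf{x}$ continuous on $[t_0-r,\infty)$ and $t\ge t_0$, $\mathbf{x}_t\in\mathscr{C}$ is $\mathbf{x}_t(\theta)=\mathbf{x}(t+\theta)$, $\theta\in[-r,0]$. For $t_0\ge0$ and $\phi\in\mathscr{C}$, $\mathbf{x}(t,t_0,\phi)$ denotes the solution for $t\ge t_0$ with $\mathbf{x}_{t_0}=\phi$. Asymptotic stability of the zero solution is meant in the usual (not necessarily uniform) sense: (stability) for every $t_0\ge0$ and $\varepsilon>0$ there is $\delta=\delta(t_0,\varepsilon)>0$ such that $\|\phi\|\le\delta$ implies that $\mathbf{x}(t,t_0,\phi)$ exists for all $t\ge t_0$ and $|\mathbf{x}(t,t_0,\phi)|<\varepsilon$ for all $t\ge t_0$; and (attractivity) for every $t_0\ge0$ there is $\delta=\delta(t_0)>0$ such that $\|\phi\|\le\delta$ implies $\lim_{t\to+\infty}\mathbf{x}(t,t_0,\phi)=0$. *)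

theory Defs
  imports "HOL-Analysis.Analysis"
begin

text \<open>
  The space of continuous functions from the interval \<open>[-r, 0]\<close> to \<open>\<real>\<^sup>n\<close>. Members are
  extensional, i.e. \<open>undefined\<close> outside the interval, so that a member is determined by
  its values on \<open>[-r, 0]\<close> and a functional on the space can only depend on those.
\<close>

definition hist_space :: "real \<Rightarrow> (real \<Rightarrow> real ^ 'n) set"
  where "hist_space r = {\<phi>. continuous_on {-r..0} \<phi> \<and> \<phi> \<in> extensional {-r..0}}"

text \<open>
  \<open>\<real>\<^sup>n\<close> carries the maximum norm, which is \<^const>\<open>infnorm\<close>; the norm of the type class on
  \<open>real ^ 'n\<close> is the Euclidean one. The definition reads only the values on \<open>[-r, 0]\<close>, so
  it may be applied to a pointwise difference without restricting it first.
\<close>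

definition hist_norm :: "real \<Rightarrow> (real \<Rightarrow> real ^ 'n) \<Rightarrow> real"
  where "hist_norm r \<phi> = (SUP \<theta>\<in>{-r..0}. infnorm (\<phi> \<theta>))"

definition hist_zero :: "real \<Rightarrow> real \<Rightarrow> real ^ 'n"
  where "hist_zero r = (\<lambda>\<theta>\<in>{-r..0}. 0)"

definition hist_ball :: "real \<Rightarrow> real \<Rightarrow> (real \<Rightarrow> real ^ 'n) set"
  where "hist_ball r L = {\<phi> \<in> hist_space r. hist_norm r \<phi> \<le> L}"

definition segment :: "real \<Rightarrow> (real \<Rightarrow> real ^ 'n) \<Rightarrow> real \<Rightarrow> real \<Rightarrow> real ^ 'n"
  where "segment r x t = (\<lambda>\<theta>\<in>{-r..0}. x (t + \<theta>))"

definition hist_continuous :: "real \<Rightarrow> ((real \<Rightarrow> real ^ 'n) \<Rightarrow> real ^ 'n) \<Rightarrow> bool"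
  where "hist_continuous r F \<longleftrightarrow>
    (\<forall>\<phi>\<in>hist_space r. \<forall>\<epsilon>>0. \<exists>\<delta>>0. \<forall>\<psi>\<in>hist_space r.
       hist_norm r (\<lambda>\<theta>. \<psi> \<theta> - \<phi> \<theta>) < \<delta> \<longrightarrow> infnorm (F \<psi> - F \<phi>) < \<epsilon>)"

definition diag_matrix :: "('n \<Rightarrow> real) \<Rightarrow> real ^ 'n ^ 'n"
  where "diag_matrix d = (\<chi> i j. if i = j then d i else 0)"

text \<open>
  \<open>x\<close> is a solution on \<open>[t0, \<infinity>)\<close> of the delay equation \<open>x'(t) = - A(t) x(t) + B(t) F(x\<^sub>t)\<close>
  with \<open>x\<^sub>t\<^sub>0 = \<phi>\<close>. The derivative is two-sided for \<open>t > t0\<close> and one-sided at \<open>t0\<close>. Values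
  of \<open>x\<close> before \<open>t0 - r\<close> are irrelevant.
\<close>

definition delay_solution ::
    "real \<Rightarrow> (real \<Rightarrow> real ^ 'n ^ 'n) \<Rightarrow> (real \<Rightarrow> real ^ 'n ^ 'n) \<Rightarrow>
     ((real \<Rightarrow> real ^ 'n) \<Rightarrow> real ^ 'n) \<Rightarrow> real \<Rightarrow> (real \<Rightarrow> real ^ 'n) \<Rightarrow>
     (real \<Rightarrow> real ^ 'n) \<Rightarrow> bool"
  where "delay_solution r A B F t0 \<phi> x \<longleftrightarrow>
    continuous_on {t0 - r..} x \<and> segment r x t0 = \<phi> \<and>
    (\<forall>t\<ge>t0. (x has_vector_derivative (- (A t *v x t) + B t *v F (segment r x t)))
               (at t within {t0..}))"

text \<open>
  The literature speaks of ``the'' solution through \<open>(t0, \<phi>)\<close>. In both definitions below this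
  is rendered as: a solution on \<open>[t0, \<infinity>)\<close> exists, and every such solution has the stated
  property. If \<open>F\<close> is Lipschitz on some \<open>hist_ball r L\<close> with \<open>L > 0\<close>, solutions that stay in
  that ball are unique.
\<close>

definition zero_stable ::
    "real \<Rightarrow> (real \<Rightarrow> real ^ 'n ^ 'n) \<Rightarrow> (real \<Rightarrow> real ^ 'n ^ 'n) \<Rightarrow>
     ((real \<Rightarrow> real ^ 'n) \<Rightarrow> real ^ 'n) \<Rightarrow> bool"
  where "zero_stable r A B F \<longleftrightarrow>
    (\<forall>t0\<ge>0. \<forall>\<epsilon>>0. \<exists>\<delta>>0. \<forall>\<phi>\<in>hist_space r. hist_norm r \<phi> \<le> \<delta> \<longrightarrow>
       (\<exists>x. delay_solution r A B F t0 \<phi> x) \<and>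
       (\<forall>x. delay_solution r A B F t0 \<phi> x \<longrightarrow> (\<forall>t\<ge>t0. infnorm (x t) < \<epsilon>)))"

definition zero_attractive ::
    "real \<Rightarrow> (real \<Rightarrow> real ^ 'n ^ 'n) \<Rightarrow> (real \<Rightarrow> real ^ 'n ^ 'n) \<Rightarrow>
     ((real \<Rightarrow> real ^ 'n) \<Rightarrow> real ^ 'n) \<Rightarrow> bool"
  where "zero_attractive r A B F \<longleftrightarrow>
    (\<forall>t0\<ge>0. \<exists>\<delta>>0. \<forall>\<phi>\<in>hist_space r. hist_norm r \<phi> \<le> \<delta> \<longrightarrow>
       (\<exists>x. delay_solution r A B F t0 \<phi> x) \<and>
       (\<forall>x. delay_solution r A B F t0 \<phi> x \<longrightarrow> (x \<longlongrightarrow> 0) at_top))"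

definition zero_asymptotically_stable ::
    "real \<Rightarrow> (real \<Rightarrow> real ^ 'n ^ 'n) \<Rightarrow> (real \<Rightarrow> real ^ 'n ^ 'n) \<Rightarrow>
     ((real \<Rightarrow> real ^ 'n) \<Rightarrow> real ^ 'n) \<Rightarrow> bool"
  where "zero_asymptotically_stable r A B F \<longleftrightarrow> zero_stable r A B F \<and> zero_attractive r A B F"

end

theory Submission
  imports Defs
begin

text \<open>
  Suppose that some \<open>\<integral>\<^sub>0\<^sup>t a\<^sub>i\<close> does not tend to infinity, and write \<open>E\<^sub>i(t) = exp (\<integral>\<^sub>0\<^sup>t a\<^sub>i)\<close>. Then
  \<open>E\<^sub>i\<close> stays below some \<open>exp Z\<close> at arbitrarily late times, while the hypothesis on the lower
  limit keeps it eventually above some \<open>exp m\<close>. The contraction hypothesis reads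
  \<open>K\<^sub>L \<integral>\<^sub>0\<^sup>t E\<^sub>i |b\<^sub>i| \<le> \<alpha> E\<^sub>i(t)\<close>; evaluated at the times where
  \<open>E\<^sub>i\<close> is small this shows that the nonnegative function \<open>E\<^sub>i |b\<^sub>i|\<close> has a finite integral over
  \<open>[0, \<infinity>)\<close>, hence a small tail (\<open>small_tail\<close>). Start the equation at a late time \<open>t\<^sub>0\<close> with
  \<open>E\<^sub>i(t\<^sub>0) < exp Z\<close>, after which that tail is small, from the constant history whose only nonzero
  entry is a small \<open>c > 0\<close> in position \<open>i\<close>.

  Integrating \<open>(E\<^sub>j x\<^sub>j)' = E\<^sub>j b\<^sub>j F\<^sub>j(x\<^sub>t)\<close> for every \<open>j\<close>, the contraction constant \<open>\<alpha> < 1\<close> gives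
  \<open>sup |x| \<le> M c / (1 - \<alpha>)\<close> (\<open>solution_bound\<close>). Here \<open>M\<close> depends only on \<open>Z\<close> and \<open>m\<close>, and not on
  \<open>t\<^sub>0\<close>: the histories of the other components vanish, so the possibly huge ratios
  \<open>E\<^sub>j(t\<^sub>0) / E\<^sub>j(t)\<close> for \<open>j \<noteq> i\<close> never enter. Consequently \<open>E\<^sub>i x\<^sub>i\<close> starts at
  \<open>E\<^sub>i(t\<^sub>0) c \<ge> c exp m\<close> and changes by at most half of \<open>c exp m\<close> in all later time. At the
  arbitrarily late times with \<open>E\<^sub>i(t) < exp Z\<close> this leaves \<open>x\<^sub>i(t) \<ge> c exp (m - Z) / 2\<close>, which
  contradicts attractivity. Stability is used only to keep the solution in the ball where \<open>F\<close> is
  Lipschitz; since the bound on \<open>sup |x|\<close> is linear in \<open>c\<close>, it does not matter how small \<open>c\<close>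
  has to be for that, nor how that depends on \<open>t\<^sub>0\<close>.
\<close>

section \<open>Integrating factors\<close>

definition integrating_factor :: "(real \<Rightarrow> real) \<Rightarrow> real \<Rightarrow> real"
  where "integrating_factor a t = exp (integral {0..t} a)"

lemma integrating_factor_pos: "integrating_factor a t > 0"
  by (simp add: integrating_factor_def)

lemma integrating_factor_deriv:
  assumes "continuous_on UNIV a" "0 \<le> u" "u \<le> t"
  shows "(integrating_factor a has_vector_derivative (integrating_factor a u * a u))
    (at u within {0..t})"
proof -
  have "((\<lambda>u. integral {0..u} a) has_vector_derivative a u) (at u within {0..t})"
    by (rule integral_has_vector_derivative) (use assms continuous_on_subset in auto)
  then have "((\<lambda>u. integral {0..u} a) has_real_derivative a u) (at u within {0..t})"
    by (simp add: has_real_derivative_iff_has_vector_derivative)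
  then have "((\<lambda>u. exp (integral {0..u} a)) has_real_derivative exp (integral {0..u} a) * a u)
      (at u within {0..t})"
    by (auto intro!: derivative_eq_intros)
  then show ?thesis
    by (simp add: integrating_factor_def[abs_def] has_real_derivative_iff_has_vector_derivative)
qed

lemma integrating_factor_continuous:
  assumes "continuous_on UNIV a"
  shows "continuous_on {0..t} (integrating_factor a)"
  by (meson assms integrating_factor_deriv atLeastAtMost_iff continuous_on_eq_continuous_within
      has_vector_derivative_continuous)

lemma weight_continuous:
  assumes "continuous_on UNIV a" "continuous_on UNIV b"
  shows "continuous_on {0..t} (\<lambda>s. integrating_factor a s * \<bar>b s\<bar>)"
  by (intro continuous_intros integrating_factor_continuous[OF assms(1)]
      continuous_on_subset[OF assms(2)]) auto

lemma weight_integrable: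
  assumes "continuous_on UNIV a" "continuous_on UNIV b" "0 \<le> s"
  shows "(\<lambda>s. integrating_factor a s * \<bar>b s\<bar>) integrable_on {s..t}"
  by (rule integrable_continuous_interval, rule continuous_on_subset, rule weight_continuous)
    (use assms in auto)

lemma weight_integral_nonneg:
  assumes "continuous_on UNIV a" "continuous_on UNIV b" "0 \<le> s"
  shows "integral {s..t} (\<lambda>s. integrating_factor a s * \<bar>b s\<bar>) \<ge> 0"
  by (rule integral_nonneg[OF weight_integrable[OF assms]])
    (simp add: integrating_factor_pos less_imp_le)

lemma weight_integral_combine:
  assumes "continuous_on UNIV a" "continuous_on UNIV b" "0 \<le> s" "s \<le> t"
  shows "integral {0..s} (\<lambda>s. integrating_factor a s * \<bar>b s\<bar>)
    + integral {s..t} (\<lambda>s. integrating_factor a s * \<bar>b s\<bar>)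
    = integral {0..t} (\<lambda>s. integrating_factor a s * \<bar>b s\<bar>)"
  by (rule Henstock_Kurzweil_Integration.integral_combine)
    (use assms weight_integrable in auto)

text \<open>
  The kernel of the contraction hypothesis is \<open>E(s) / E(t)\<close>, so that the factor \<open>1 / E(t)\<close> can be
  taken out of the integral.
\<close>

lemma kernel_integral_eq:
  assumes "continuous_on UNIV a"
  shows "integral {0..t} (\<lambda>s. exp (- integral {s..t} a) * \<bar>b s\<bar>)
    = integral {0..t} (\<lambda>s. integrating_factor a s * \<bar>b s\<bar>) / integrating_factor a t"
proof -
  have "exp (- integral {s..t} a) * \<bar>b s\<bar>
      = integrating_factor a s * \<bar>b s\<bar> / integrating_factor a t" if "s \<in> {0..t}" for s
  proof -
    have "integral {0..s} a + integral {s..t} a = integral {0..t} a"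
      by (rule Henstock_Kurzweil_Integration.integral_combine)
        (use that assms in \<open>auto intro!: integrable_continuous_interval
          intro: continuous_on_subset\<close>)
    then have "- integral {s..t} a = integral {0..s} a - integral {0..t} a"
      by simp
    then show ?thesis
      by (simp add: integrating_factor_def exp_diff)
  qed
  then have "integral {0..t} (\<lambda>s. exp (- integral {s..t} a) * \<bar>b s\<bar>)
      = integral {0..t} (\<lambda>s. integrating_factor a s * \<bar>b s\<bar> / integrating_factor a t)"
    by (rule Henstock_Kurzweil_Integration.integral_cong)
  then show ?thesis
    by simp
qed

text \<open>
  Variation of constants, as an inequality: \<open>(E y)' = E b f\<close>. The fundamental theorem of
  calculus provides the gauge integrability of the derivative \<open>E b f\<close> along with the value of its
  integral, so that nothing but the bound \<open>C\<close> has to be known about the delayed term \<open>f\<close>.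
\<close>

lemma scalar_variation_bound:
  fixes y f :: "real \<Rightarrow> real"
  assumes a: "continuous_on UNIV a" and b: "continuous_on UNIV b"
    and t: "0 \<le> t0" "t0 \<le> t"
    and y: "\<And>s. t0 \<le> s \<Longrightarrow> s \<le> t \<Longrightarrow>
      (y has_vector_derivative (- (a s * y s) + b s * f s)) (at s within {t0..t})"
    and f: "\<And>s. t0 \<le> s \<Longrightarrow> s \<le> t \<Longrightarrow> \<bar>f s\<bar> \<le> C"
  shows "\<bar>integrating_factor a t * y t - integrating_factor a t0 * y t0\<bar>
    \<le> C * integral {t0..t} (\<lambda>s. integrating_factor a s * \<bar>b s\<bar>)"
proof -
  let ?E = "integrating_factor a"
  have "((\<lambda>s. ?E s * y s) has_vector_derivative (?E s * (b s * f s))) (at s within {t0..t})"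
    if "s \<in> {t0..t}" for s
  proof -
    have "(?E has_vector_derivative (?E s * a s)) (at s within {t0..t})"
      by (rule has_vector_derivative_within_subset[OF integrating_factor_deriv[OF a]])
        (use that t in auto)
    from has_vector_derivative_mult[OF this y] that show ?thesis
      by (simp add: algebra_simps)
  qed
  then have I: "((\<lambda>s. ?E s * (b s * f s)) has_integral (?E t * y t - ?E t0 * y t0)) {t0..t}"
    by (rule fundamental_theorem_of_calculus[OF t(2)])
  have "norm (integral {t0..t} (\<lambda>s. ?E s * (b s * f s)))
      \<le> integral {t0..t} (\<lambda>s. C * (?E s * \<bar>b s\<bar>))"
  proof (rule integral_norm_bound_integral)
    show "(\<lambda>s. ?E s * (b s * f s)) integrable_on {t0..t}"
      using I by blast
    show "(\<lambda>s. C * (?E s * \<bar>b s\<bar>)) integrable_on {t0..t}"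
      using weight_integrable[OF a b t(1)] by (rule integrable_on_mult_right)
    fix s assume "s \<in> {t0..t}"
    then have "\<bar>b s\<bar> * \<bar>f s\<bar> \<le> \<bar>b s\<bar> * C"
      using f by (intro mult_left_mono) auto
    then have "?E s * (\<bar>b s\<bar> * \<bar>f s\<bar>) \<le> ?E s * (\<bar>b s\<bar> * C)"
      by (rule mult_left_mono) (simp add: integrating_factor_pos less_imp_le)
    also have "\<dots> = C * (?E s * \<bar>b s\<bar>)"
      by simp
    finally show "norm (?E s * (b s * f s)) \<le> C * (?E s * \<bar>b s\<bar>)"
      using integrating_factor_pos[of a s] by (simp only: real_norm_def abs_mult abs_of_pos)
  qed
  then show ?thesis
    using integral_unique[OF I] by simp
qed

section \<open>Histories and the delayed term\<close>

lemma infnorm_le_cart: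
  fixes x :: "real ^ 'n"
  assumes "\<And>i. \<bar>x $ i\<bar> \<le> c"
  shows "infnorm x \<le> c"
  unfolding infnorm_cart by (rule cSup_least) (use assms in auto)

lemma diag_matrix_mult_nth: "(diag_matrix d *v x) $ i = d i * x $ i"
proof -
  have "(\<Sum>j\<in>UNIV. (if i = j then d i else 0) * x $ j) = (\<Sum>j\<in>UNIV. if i = j then d i * x $ j else 0)"
    by (rule sum.cong) auto
  then show ?thesis
    by (simp add: diag_matrix_def matrix_vector_mult_def)
qed

lemma hist_norm_le:
  assumes "r \<ge> 0" "\<And>\<theta>. \<theta> \<in> {-r..0} \<Longrightarrow> infnorm (\<phi> \<theta>) \<le> c"
  shows "hist_norm r \<phi> \<le> c"
  unfolding hist_norm_def by (rule cSUP_least) (use assms in auto)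

lemma hist_zero_in_hist_ball:
  assumes "r \<ge> 0" "L \<ge> 0"
  shows "hist_zero r \<in> hist_ball r L"
proof -
  have "continuous_on {-r..0} (hist_zero r)"
    by (rule continuous_on_eq[of _ "\<lambda>_. 0"]) (auto simp: hist_zero_def)
  moreover have "hist_norm r (hist_zero r) \<le> L"
    by (rule hist_norm_le) (use assms in \<open>simp_all add: hist_zero_def infnorm_eq_0[THEN iffD2]\<close>)
  ultimately show ?thesis
    by (auto simp: hist_ball_def hist_space_def hist_zero_def)
qed

lemma segment_in_hist_ball:
  assumes "r \<ge> 0" "continuous_on {t0 - r..} x" "t \<ge> t0"
    and "\<And>s. s \<ge> t0 - r \<Longrightarrow> infnorm (x s) \<le> L"
  shows "segment r x t \<in> hist_ball r L"
proof -
  have "continuous_on {-r..0} (\<lambda>\<theta>. x (t + \<theta>))"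
    by (rule continuous_on_compose2[OF assms(2)]) (use assms in \<open>auto intro!: continuous_intros\<close>)
  then have "continuous_on {-r..0} (segment r x t)"
    by (rule continuous_on_eq) (auto simp: segment_def)
  moreover have "hist_norm r (segment r x t) \<le> L"
    by (rule hist_norm_le) (use assms in \<open>auto simp: segment_def\<close>)
  ultimately show ?thesis
    by (auto simp: hist_ball_def hist_space_def segment_def)
qed

text \<open>
  As \<open>F\<close> vanishes at the zero history, its Lipschitz bound on the ball of radius \<open>L\<close> becomes a
  linear growth bound. A global bound \<open>S\<close> on the solution, rather than \<open>L\<close> itself, is what allows
  the estimate of the solution to be closed below.
\<close>

lemma functional_segment_bound:
  fixes F :: "(real \<Rightarrow> real ^ 'n) \<Rightarrow> real ^ 'n"
  assumes "r \<ge> 0" "K \<ge> 0" "L \<ge> 0" "F (hist_zero r) = 0"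
    and lip: "\<And>\<phi> \<psi>. \<lbrakk>\<phi> \<in> hist_ball r L; \<psi> \<in> hist_ball r L\<rbrakk> \<Longrightarrow>
          infnorm (F \<phi> - F \<psi>) \<le> K * hist_norm r (\<lambda>\<theta>. \<phi> \<theta> - \<psi> \<theta>)"
    and x: "continuous_on {t0 - r..} x" "\<And>s. s \<ge> t0 - r \<Longrightarrow> infnorm (x s) \<le> L"
      "\<And>s. s \<ge> t0 - r \<Longrightarrow> infnorm (x s) \<le> S"
    and t: "t \<ge> t0"
  shows "\<bar>F (segment r x t) $ i\<bar> \<le> K * S"
proof -
  have "infnorm (F (segment r x t) - F (hist_zero r))
      \<le> K * hist_norm r (\<lambda>\<theta>. segment r x t \<theta> - hist_zero r \<theta>)"
    by (intro lip segment_in_hist_ball hist_zero_in_hist_ball) (use assms in auto)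
  also have "\<dots> \<le> K * S"
    by (intro mult_left_mono hist_norm_le)
      (use assms in \<open>auto simp: segment_def hist_zero_def\<close>)
  finally show ?thesis
    using component_le_infnorm_cart[of "F (segment r x t)" i] assms(4) by simp
qed

section \<open>Bounds for solutions\<close>

lemma solution_component_variation:
  fixes x :: "real \<Rightarrow> real ^ 'n" and a b :: "'n::finite \<Rightarrow> real \<Rightarrow> real"
  assumes a: "continuous_on UNIV (a i)" and b: "continuous_on UNIV (b i)"
    and A: "\<And>t. A t = diag_matrix (\<lambda>i. a i t)" and B: "\<And>t. B t = diag_matrix (\<lambda>i. b i t)"
    and sol: "delay_solution r A B F t0 \<phi> x"
    and F: "\<And>t. t \<ge> t0 \<Longrightarrow> \<bar>F (segment r x t) $ i\<bar> \<le> C"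
    and t: "0 \<le> t0" "t0 \<le> t"
  shows "\<bar>integrating_factor (a i) t * x t $ i - integrating_factor (a i) t0 * x t0 $ i\<bar>
    \<le> C * integral {t0..t} (\<lambda>s. integrating_factor (a i) s * \<bar>b i s\<bar>)"
proof (rule scalar_variation_bound[OF a b t, where f = "\<lambda>s. F (segment r x s) $ i"])
  fix s assume s: "t0 \<le> s" "s \<le> t"
  then have "(x has_vector_derivative (- (A s *v x s) + B s *v F (segment r x s)))
      (at s within {t0..})"
    using sol by (simp add: delay_solution_def)
  then have "(x has_vector_derivative (- (A s *v x s) + B s *v F (segment r x s)))
      (at s within {t0..t})"
    by (rule has_vector_derivative_within_subset) auto
  from bounded_linear.has_vector_derivative[OF bounded_linear_vec_nth[of i] this]
  show "((\<lambda>t. x t $ i) has_vector_derivative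
      (- (a i s * x s $ i) + b i s * F (segment r x s) $ i)) (at s within {t0..t})"
    by (simp add: A B diag_matrix_mult_nth)
qed (use F in auto)

text \<open>
  Let \<open>S\<close> be the supremum of \<open>|x|\<close>, finite because \<open>|x| \<le> L\<close>. The homogeneous part
  \<open>(E\<^sub>i(t0) / E\<^sub>i(t)) x\<^sub>i(t0)\<close> contributes at most \<open>m\<close> and the delayed part at most \<open>\<alpha> S\<close>, whence
  \<open>S \<le> m + \<alpha> S\<close>. The hypothesis on the homogeneous part is kept separate for each component
  since it is trivially satisfied by those that start at zero.
\<close>

lemma solution_bound:
  fixes x :: "real \<Rightarrow> real ^ 'n" and a b :: "'n::finite \<Rightarrow> real \<Rightarrow> real"
  assumes r: "r \<ge> 0"
    and a: "\<And>i. continuous_on UNIV (a i)" and b: "\<And>i. continuous_on UNIV (b i)"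
    and A: "\<And>t. A t = diag_matrix (\<lambda>i. a i t)" and B: "\<And>t. B t = diag_matrix (\<lambda>i. b i t)"
    and K: "K \<ge> 0" and L: "L \<ge> 0" and F0: "F (hist_zero r) = 0"
    and lip: "\<And>\<phi> \<psi>. \<lbrakk>\<phi> \<in> hist_ball r L; \<psi> \<in> hist_ball r L\<rbrakk> \<Longrightarrow>
          infnorm (F \<phi> - F \<psi>) \<le> K * hist_norm r (\<lambda>\<theta>. \<phi> \<theta> - \<psi> \<theta>)"
    and \<alpha>: "\<alpha> < 1" and contr: "\<And>t i. t \<ge> 0 \<Longrightarrow>
      K * integral {0..t} (\<lambda>s. integrating_factor (a i) s * \<bar>b i s\<bar>)
        \<le> \<alpha> * integrating_factor (a i) t"
    and t0: "t0 \<ge> 0" and sol: "delay_solution r A B F t0 \<phi> x"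
    and xL: "\<And>s. s \<ge> t0 - r \<Longrightarrow> infnorm (x s) \<le> L"
    and hist: "\<And>s. t0 - r \<le> s \<Longrightarrow> s \<le> t0 \<Longrightarrow> infnorm (x s) \<le> m"
    and homogeneous: "\<And>t i. t \<ge> t0 \<Longrightarrow>
      integrating_factor (a i) t0 * \<bar>x t0 $ i\<bar> \<le> m * integrating_factor (a i) t"
    and s: "s \<ge> t0 - r"
  shows "infnorm (x s) \<le> m / (1 - \<alpha>)"
proof -
  let ?E = "\<lambda>i. integrating_factor (a i)"
  let ?w = "\<lambda>i s. ?E i s * \<bar>b i s\<bar>"
  define S where "S = (SUP s\<in>{t0 - r..}. infnorm (x s))"
  have bdd: "bdd_above ((\<lambda>s. infnorm (x s)) ` {t0 - r..})"
    using xL by (intro bdd_aboveI2) auto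
  have xS: "infnorm (x s) \<le> S" if "s \<ge> t0 - r" for s
    unfolding S_def by (rule cSUP_upper[OF _ bdd]) (use that in auto)
  have S0: "S \<ge> 0"
    using xS[of t0] infnorm_pos_le[of "x t0"] r by linarith
  have cont: "continuous_on {t0 - r..} x"
    using sol by (simp add: delay_solution_def)
  have "\<alpha> * integrating_factor (a undefined) 0 \<ge> 0"
    using contr[of 0 undefined] by simp
  then have \<alpha>0: "\<alpha> \<ge> 0"
    using integrating_factor_pos[of "a undefined" 0] by (simp add: integrating_factor_def)
  have F_bound: "\<bar>F (segment r x t) $ i\<bar> \<le> K * S" if "t \<ge> t0" for t i
    by (rule functional_segment_bound[OF r K L F0 lip cont xL xS that])
  have late: "\<bar>x t $ i\<bar> \<le> m + \<alpha> * S" if t: "t \<ge> t0" for t i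
  proof -
    have E: "?E i t > 0" "?E i t0 > 0"
      by (rule integrating_factor_pos)+
    have "\<bar>?E i t * x t $ i - ?E i t0 * x t0 $ i\<bar> \<le> K * S * integral {t0..t} (?w i)"
      by (rule solution_component_variation[OF a b A B sol F_bound t0 t])
    also have "\<dots> \<le> K * S * integral {0..t} (?w i)"
      using weight_integral_combine[OF a[of i] b[of i] t0 t]
        weight_integral_nonneg[OF a[of i] b[of i], of 0 t0] S0 K by (intro mult_left_mono) auto
    also have "\<dots> = S * (K * integral {0..t} (?w i))"
      by simp
    also have "\<dots> \<le> S * (\<alpha> * ?E i t)"
      using contr[of t i] t t0 S0 by (intro mult_left_mono) auto
    finally have "\<bar>?E i t * x t $ i\<bar> \<le> \<bar>?E i t0 * x t0 $ i\<bar> + S * (\<alpha> * ?E i t)"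
      by linarith
    also have "\<dots> \<le> m * ?E i t + S * (\<alpha> * ?E i t)"
      using homogeneous[OF t, of i] E by (simp add: abs_mult)
    finally have "?E i t * \<bar>x t $ i\<bar> \<le> ?E i t * (m + \<alpha> * S)"
      using E by (simp add: abs_mult algebra_simps)
    then show ?thesis
      using E by simp
  qed
  have "infnorm (x s) \<le> m + \<alpha> * S" if "s \<ge> t0 - r" for s
  proof (cases "s \<ge> t0")
    case True
    then show ?thesis
      by (intro infnorm_le_cart late)
  next
    case False
    then have "infnorm (x s) \<le> m"
      using hist that by auto
    then show ?thesis
      using mult_nonneg_nonneg[OF \<alpha>0 S0] by linarith
  qed
  then have "S \<le> m + \<alpha> * S"
    unfolding S_def by (intro cSUP_least) auto
  then have "S * (1 - \<alpha>) \<le> m"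
    by (simp add: algebra_simps)
  then have "S \<le> m / (1 - \<alpha>)"
    using \<alpha> by (simp add: pos_le_divide_eq)
  then show ?thesis
    using xS[OF s] by simp
qed

section \<open>Divergence of the integrals\<close>

text \<open>
  Along the times with \<open>E(t) < exp Z\<close> the contraction hypothesis bounds \<open>\<integral>\<^sub>0\<^sup>t E |b|\<close>, hence
  everywhere, as that integral increases with \<open>t\<close>.
\<close>

lemma small_tail:
  assumes a: "continuous_on UNIV a" and b: "continuous_on UNIV b"
    and K: "K > 0" and \<alpha>: "\<alpha> \<ge> 0"
    and contr: "\<And>t. t \<ge> 0 \<Longrightarrow>
      K * integral {0..t} (\<lambda>s. integrating_factor a s * \<bar>b s\<bar>) \<le> \<alpha> * integrating_factor a t"
    and Z: "\<And>T. \<exists>t\<ge>T. integral {0..t} a < Z"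
    and \<eta>: "\<eta> > 0"
  obtains T where "T \<ge> 0"
    "\<And>s t. T \<le> s \<Longrightarrow> s \<le> t \<Longrightarrow> integral {s..t} (\<lambda>s. integrating_factor a s * \<bar>b s\<bar>) \<le> \<eta>"
proof -
  let ?w = "\<lambda>s. integrating_factor a s * \<bar>b s\<bar>"
  let ?G = "\<lambda>t. integral {0..t} ?w"
  have mono: "?G s \<le> ?G t" if "0 \<le> s" "s \<le> t" for s t
    using weight_integral_combine[OF a b that] weight_integral_nonneg[OF a b that(1), of t] by linarith
  have "?G t \<le> \<alpha> * exp Z / K" if "t \<ge> 0" for t
  proof -
    obtain u where u: "u \<ge> t" "integral {0..u} a < Z"
      using Z by blast
    have "?G t * K \<le> K * ?G u"
      using mono[OF that u(1)] K by simp
    also have "\<dots> \<le> \<alpha> * integrating_factor a u"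
      using contr u that by simp
    also have "\<dots> \<le> \<alpha> * exp Z"
      using u \<alpha> by (intro mult_left_mono) (auto simp: integrating_factor_def)
    finally show ?thesis
      using K by (simp add: pos_le_divide_eq)
  qed
  then have bdd: "bdd_above (?G ` {0..})"
    by (intro bdd_aboveI2) auto
  have "\<exists>T\<in>{0..}. (SUP t\<in>{0..}. ?G t) - \<eta> < ?G T"
    using less_cSUP_iff[of "{0..}" ?G "(SUP t\<in>{0..}. ?G t) - \<eta>"] bdd \<eta> by auto
  then obtain T where T: "T \<ge> 0" "(SUP t\<in>{0..}. ?G t) - \<eta> < ?G T"
    by auto
  have "integral {s..t} ?w \<le> \<eta>" if "T \<le> s" "s \<le> t" for s t
  proof -
    have "?G t \<le> (SUP t\<in>{0..}. ?G t)"
      by (rule cSUP_upper[OF _ bdd]) (use that T in auto)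
    moreover have "?G T \<le> ?G s"
      using mono that T by simp
    moreover have "?G s + integral {s..t} ?w = ?G t"
      using weight_integral_combine[OF a b, of s t] that T by simp
    ultimately show ?thesis
      using T by linarith
  qed
  with T(1) show thesis
    using that by blast
qed

lemma eventually_ge_of_Liminf:
  fixes f :: "real \<Rightarrow> real"
  assumes "Liminf at_top (\<lambda>t. ereal (f t)) > - \<infinity>"
  obtains m T where "\<And>t. t \<ge> T \<Longrightarrow> f t \<ge> m"
proof -
  obtain y where y: "y < Liminf at_top (\<lambda>t. ereal (f t))" "y > - \<infinity>"
    using dense[OF assms] by blast
  then obtain m where m: "y = ereal m"
    by (cases y) auto
  have "eventually (\<lambda>t. ereal m < ereal (f t)) at_top"
    using less_LiminfD[OF y(1)] m by simp
  then obtain T where "\<forall>t\<ge>T. m < f t"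
    by (auto simp: eventually_at_top_linorder)
  with that show thesis
    by (meson less_imp_le)
qed

theorem theorem3p2:
  fixes r L K\<^sub>L :: real
    and a b :: "'n::finite \<Rightarrow> real \<Rightarrow> real"
    and F :: "(real \<Rightarrow> real ^ 'n) \<Rightarrow> real ^ 'n"
    and A B :: "real \<Rightarrow> real ^ 'n ^ 'n"
  assumes r_pos: "r > 0"
    and a_cont: "\<And>i. continuous_on UNIV (a i)"
    and b_cont: "\<And>i. continuous_on UNIV (b i)"
    and A_diag: "\<And>t. A t = diag_matrix (\<lambda>i. a i t)"
    and B_diag: "\<And>t. B t = diag_matrix (\<lambda>i. b i t)"
    and F_cont: "hist_continuous r F"
    and F_zero: "F (hist_zero r) = 0"
    and L_pos: "L > 0"
    and K_pos: "K\<^sub>L > 0"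
    and F_lipschitz: "\<And>\<phi> \<psi>. \<lbrakk>\<phi> \<in> hist_ball r L; \<psi> \<in> hist_ball r L\<rbrakk> \<Longrightarrow>
          infnorm (F \<phi> - F \<psi>) \<le> K\<^sub>L * hist_norm r (\<lambda>\<theta>. \<phi> \<theta> - \<psi> \<theta>)"
    and contraction: "\<exists>\<alpha>. 0 < \<alpha> \<and> \<alpha> < 1 \<and> (\<forall>t\<ge>0. \<forall>i.
          K\<^sub>L * integral {0..t} (\<lambda>s. exp (- integral {s..t} (a i)) * \<bar>b i s\<bar>) \<le> \<alpha>)"
    and liminf: "\<And>i. Liminf at_top (\<lambda>t. ereal (integral {0..t} (a i))) > - \<infinity>"
    and stable: "zero_asymptotically_stable r A B F"
  shows "\<forall>i. filterlim (\<lambda>t. integral {0..t} (a i)) at_top at_top"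
proof (rule allI, rule ccontr)
  fix i
  assume neg: "\<not> filterlim (\<lambda>t. integral {0..t} (a i)) at_top at_top"
  let ?E = "integrating_factor (a i)"
  obtain \<alpha> where \<alpha>: "0 < \<alpha>" "\<alpha> < 1" and contr0: "\<And>t i. t \<ge> 0 \<Longrightarrow>
      K\<^sub>L * integral {0..t} (\<lambda>s. exp (- integral {s..t} (a i)) * \<bar>b i s\<bar>) \<le> \<alpha>"
    using contraction by blast
  have contr: "K\<^sub>L * integral {0..t} (\<lambda>s. integrating_factor (a i) s * \<bar>b i s\<bar>)
      \<le> \<alpha> * integrating_factor (a i) t" if "t \<ge> 0" for t i
    using contr0[OF that, of i] integrating_factor_pos[of "a i" t]
    by (simp add: kernel_integral_eq[OF a_cont] pos_divide_le_eq)
  obtain Z where Z: "\<And>T. \<exists>t\<ge>T. integral {0..t} (a i) < Z"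
    using neg by (auto simp: filterlim_at_top eventually_at_top_linorder not_le)
  obtain m T1 where m: "\<And>t. t \<ge> T1 \<Longrightarrow> integral {0..t} (a i) \<ge> m"
    using eventually_ge_of_Liminf[OF liminf] by blast
  \<comment> \<open>\<open>M\<close> bounds the ratios \<open>?E t0 / ?E t\<close>, and is at least 1 to cover the initial segment; \<open>\<eta>\<close>
    solves \<open>K\<^sub>L (M / (1 - \<alpha>)) \<eta> = exp m / 2\<close>.\<close>
  define M where "M = max 1 (exp (Z - m))"
  define \<eta> where "\<eta> = exp m * (1 - \<alpha>) / (2 * K\<^sub>L * M)"
  have M: "M \<ge> 1" "exp Z \<le> M * exp m"
    by (auto simp: M_def exp_diff max_def field_simps)
  have \<eta>: "\<eta> > 0"
    using \<alpha> K_pos M by (simp add: \<eta>_def)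
  obtain T2 where T2: "T2 \<ge> 0" "\<And>s t. T2 \<le> s \<Longrightarrow> s \<le> t \<Longrightarrow>
      integral {s..t} (\<lambda>s. ?E s * \<bar>b i s\<bar>) \<le> \<eta>"
    using small_tail[OF a_cont b_cont K_pos _ contr Z \<eta>] \<alpha> by (metis less_imp_le)
  obtain t0 where t0: "t0 \<ge> max T1 T2" "integral {0..t0} (a i) < Z"
    using Z by blast
  have t0_nonneg: "t0 \<ge> 0"
    using t0 T2 by simp
  have E_ge: "?E t \<ge> exp m" if "t \<ge> t0" for t
    using m that t0 by (simp add: integrating_factor_def)
  obtain \<delta>1 where \<delta>1: "\<delta>1 > 0" "\<And>\<phi> x. \<phi> \<in> hist_space r \<Longrightarrow> hist_norm r \<phi> \<le> \<delta>1 \<Longrightarrow>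
      delay_solution r A B F t0 \<phi> x \<Longrightarrow> (\<forall>t\<ge>t0. infnorm (x t) < L)"
    using stable t0_nonneg L_pos unfolding zero_asymptotically_stable_def zero_stable_def by metis
  obtain \<delta>2 where \<delta>2: "\<delta>2 > 0" "\<And>\<phi>. \<phi> \<in> hist_space r \<Longrightarrow> hist_norm r \<phi> \<le> \<delta>2 \<Longrightarrow>
      (\<exists>x. delay_solution r A B F t0 \<phi> x) \<and>
      (\<forall>x. delay_solution r A B F t0 \<phi> x \<longrightarrow> (x \<longlongrightarrow> 0) at_top)"
    using stable t0_nonneg unfolding zero_asymptotically_stable_def zero_attractive_def by metis
  define c where "c = min L (min \<delta>1 \<delta>2)"
  have c: "c > 0" "c \<le> L" "c \<le> \<delta>1" "c \<le> \<delta>2"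
    using L_pos \<delta>1 \<delta>2 by (auto simp: c_def)
  define \<phi> :: "real \<Rightarrow> real ^ 'n" where "\<phi> = (\<lambda>\<theta>\<in>{-r..0}. axis i c)"
  have axis_le: "infnorm (axis i c :: real ^ 'n) \<le> c"
    by (rule infnorm_le_cart) (use c in \<open>simp add: axis_def\<close>)
  have "continuous_on {-r..0} \<phi>"
    by (rule continuous_on_eq[of _ "\<lambda>_. axis i c"]) (auto simp: \<phi>_def)
  then have \<phi>: "\<phi> \<in> hist_space r"
    by (auto simp: hist_space_def \<phi>_def)
  have \<phi>_norm: "hist_norm r \<phi> \<le> c"
    by (rule hist_norm_le) (use r_pos axis_le in \<open>auto simp: \<phi>_def\<close>)
  obtain x where sol: "delay_solution r A B F t0 \<phi> x" and lim: "(x \<longlongrightarrow> 0) at_top"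
    using \<delta>2(2)[OF \<phi>] \<phi>_norm c by auto
  have cont: "continuous_on {t0 - r..} x" and seg: "segment r x t0 = \<phi>"
    using sol by (auto simp: delay_solution_def)
  have hist: "x s = axis i c" if "t0 - r \<le> s" "s \<le> t0" for s
    using fun_cong[OF seg, of "s - t0"] that by (auto simp: segment_def \<phi>_def)
  have xL: "infnorm (x s) \<le> L" if "s \<ge> t0 - r" for s
  proof (cases "s \<ge> t0")
    case True
    then show ?thesis
      using \<delta>1(2)[OF \<phi> _ sol] \<phi>_norm c by (simp add: less_imp_le)
  next
    case False
    then show ?thesis
      using hist[OF that] axis_le c by simp
  qed
  have bound: "infnorm (x s) \<le> M * c / (1 - \<alpha>)" if "s \<ge> t0 - r" for s
  proof (rule solution_bound[OF _ a_cont b_cont A_diag B_diag _ _ F_zero F_lipschitz \<alpha>(2) contr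
        t0_nonneg sol xL _ _ that])
    have cM: "c \<le> M * c"
      using M c by simp
    show "infnorm (x s) \<le> M * c" if "t0 - r \<le> s" "s \<le> t0" for s
      using hist[OF that] axis_le cM by simp
    show "integrating_factor (a j) t0 * \<bar>x t0 $ j\<bar> \<le> M * c * integrating_factor (a j) t"
      if t: "t \<ge> t0" for t j
    proof (cases "j = i")
      case True
      have "?E t0 \<le> exp Z"
        using t0 by (simp add: integrating_factor_def)
      also have "\<dots> \<le> M * ?E t"
        using M E_ge[OF t] by (meson mult_left_mono order_trans zero_le_one)
      finally show ?thesis
        using hist[of t0] r_pos c True by (simp add: axis_def mult_right_mono mult.commute mult.left_commute)
    next
      case False
      then show ?thesis
        using hist[of t0] r_pos c M integrating_factor_pos[of "a j" t] by (simp add: axis_def)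
    qed
  qed (use r_pos K_pos L_pos in auto)
  have low: "?E t * x t $ i \<ge> c * exp m / 2" if t: "t \<ge> t0" for t
  proof -
    have "\<bar>?E t * x t $ i - ?E t0 * x t0 $ i\<bar>
        \<le> K\<^sub>L * (M * c / (1 - \<alpha>)) * integral {t0..t} (\<lambda>s. ?E s * \<bar>b i s\<bar>)"
      by (rule solution_component_variation[OF a_cont b_cont A_diag B_diag sol _ t0_nonneg t],
          rule functional_segment_bound[OF _ _ _ F_zero F_lipschitz cont xL bound])
        (use r_pos K_pos L_pos in auto)
    also have "\<dots> \<le> K\<^sub>L * (M * c / (1 - \<alpha>)) * \<eta>"
      using T2(2)[of t0 t] t t0 K_pos M c \<alpha> by (intro mult_left_mono) auto
    also have "\<dots> = c * exp m / 2"
      using K_pos M \<alpha> by (simp add: \<eta>_def)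
    finally have "?E t * x t $ i \<ge> ?E t0 * x t0 $ i - c * exp m / 2"
      by linarith
    moreover have "x t0 $ i = c"
      using hist[of t0] r_pos by (simp add: axis_def)
    moreover have "?E t0 * c \<ge> exp m * c"
      using E_ge[of t0] c by simp
    ultimately show ?thesis
      by (simp add: mult.commute[of c])
  qed
  have "((\<lambda>t. x t $ i) \<longlongrightarrow> 0) at_top"
    using tendsto_vec_nth[OF lim, of i] by simp
  moreover have "c * exp m / 2 / exp Z > 0"
    using c by simp
  ultimately have "eventually (\<lambda>t. x t $ i < c * exp m / 2 / exp Z) at_top"
    by (rule order_tendstoD(2))
  then obtain T3 where T3: "\<And>t. t \<ge> T3 \<Longrightarrow> x t $ i < c * exp m / 2 / exp Z"
    by (auto simp: eventually_at_top_linorder)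
  obtain t where t: "t \<ge> max t0 T3" "integral {0..t} (a i) < Z"
    using Z by blast
  have "?E t * x t $ i < ?E t * (c * exp m / 2 / exp Z)"
    using T3[of t] t by (intro mult_strict_left_mono integrating_factor_pos) auto
  also have "\<dots> \<le> exp Z * (c * exp m / 2 / exp Z)"
    using t c by (intro mult_right_mono) (auto simp: integrating_factor_def)
  also have "\<dots> = c * exp m / 2"
    by simp
  finally show False
    using low[of t] t by simp
qed

end
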